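(* Let $1/2<\theta<1$ and let $\mathcal{B}$ be an infinite set of primes such that $\sum_{p\in\mathcal{B}} p^{-\sigma}<\infty$ for some $\sigma<\theta$. Let $k,u$ be fixed positive integers with $\gcd(k,u)=1$. Then for all large positive integers $Q$, \[\mathcal{M}_{1,\mathcal{B}}(u,k,Q)=\frac{3Q^2}{2\phi(k)\zeta(2)}\prod_{\substack{p\in\mathcal{B}\\ p\nmid k}}\left(1+\frac1p\right)^{-1}\prod_{p\mid k}\left(1+\frac1p\right)^{-1}+O_{k,\mathcal{B}}\left(Q^{1+\theta}(\log Q)^{3/2}\right).\]
   Context: $\mathcal{F}_Q$ is the Farey sequence of order $Q$: the increasing sequence $1/Q=\gamma_1<\gamma_2<\dots<\gamma_{N}=1$ of all fractions $a/q$ in $(0,1]$ with $\gcd(a,q)=1$ and $0<a\le q\le Q$. Write $\gamma_i=a_i/q_i$ in lowest terms. The index of $\gamma_i$ is $\nu(\gamma_i)=\nu_Q(\gamma_i)=\frac{q_{i-1}+q_{i+1}}{q_i}$ (an integer), with the conventions $\nu_Q(\gamma_1)=1$ and $\nu_Q(\gamma_N)=2Q$. Given an infinite set $\mathcal{B}$ of integers greater than $1$, a positive integer is $\mathcal{B}$-free if it is divisible by no element of $\mathcal{B}$. For a positive integer $l$, \[\mathcal{M}_{l,\mathcal{B}}(u,k,Q)=\sum_{\substack{\gamma_i=b/s\in\mathcal{F}_Q\\ s\equiv u \pmod k\\ s\text{ is }\mathcal{B}\text{-free}}}\nu(\gamma_i)^l,\] where $b/s$ is in lowest terms. $\phi$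 is Euler's totient function, $\zeta$ is the Riemann zeta function, and $p$ always denotes a prime. *)

theory Defs
  imports "HOL-Analysis.Analysis" "HOL-Number_Theory.Number_Theory"
begin

definition farey_set :: "nat \<Rightarrow> rat set" where
  "farey_set Q =
     {of_nat a / of_nat q | a q. coprime a q \<and> 0 < a \<and> a \<le> q \<and> q \<le> Q}"

lemma finite_farey_set: "finite (farey_set Q)"
proof (rule finite_subset)
  show "farey_set Q \<subseteq> (\<lambda>(a, q). of_nat a / of_nat q) ` ({..Q} \<times> {..Q})"
    unfolding farey_set_def by force
  show "finite ((\<lambda>(a, q). of_nat a / of_nat q :: rat) ` ({..Q} \<times> {..Q}))"
    by simp
qed

definition farey_len :: "nat \<Rightarrow> nat" where
  "farey_len Q = card (farey_set Q)"

text \<open>Terms are numbered from 1; meaningful for \<open>1 \<le> i \<le> farey_len Q\<close>.\<close>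

definition farey :: "nat \<Rightarrow> nat \<Rightarrow> rat" where
  "farey Q i = sorted_list_of_set (farey_set Q) ! (i - 1)"

text \<open>Denominator in lowest terms (\<open>quotient_of\<close> normalises, with positive denominator).\<close>

definition farey_denom :: "nat \<Rightarrow> nat \<Rightarrow> nat" where
  "farey_denom Q i = nat (snd (quotient_of (farey Q i)))"

text \<open>
  The index of the \<open>i\<close>-th term, with the conventional values at the two ends.  For \<open>Q = 1\<close>
  the two ends coincide and the conventions clash; we then use the first one.  The quotient
  is an integer, but it is taken in the reals so that no truncation is involved.
\<close>

definition farey_index :: "nat \<Rightarrow> nat \<Rightarrow> real" where
  "farey_index Q i =
     (if i = 1 then 1
      else if i = farey_len Q then 2 * real Q
      else (real (farey_denom Q (i - 1)) + real (farey_denom Q (i + 1)))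
             / real (farey_denom Q i))"

definition B_free :: "nat set \<Rightarrow> nat \<Rightarrow> bool" where
  "B_free B n \<longleftrightarrow> 0 < n \<and> (\<forall>b\<in>B. \<not> b dvd n)"

definition farey_moment :: "nat \<Rightarrow> nat set \<Rightarrow> nat \<Rightarrow> nat \<Rightarrow> nat \<Rightarrow> real" where
  "farey_moment l B u k Q =
     (\<Sum>i | i \<in> {1..farey_len Q} \<and> [farey_denom Q i = u] (mod k) \<and> B_free B (farey_denom Q i).
        farey_index Q i ^ l)"

text \<open>The Riemann zeta function at real arguments \<open>s > 1\<close>, by its Dirichlet series.\<close>

definition zeta :: "real \<Rightarrow> real" where
  "zeta s = (\<Sum>n. 1 / real (Suc n) powr s)"

end

theory Submission
  imports Defs "HOL-Real_Asymp.Real_Asymp"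
begin

text \<open>
  Adjacent Farey fractions have determinant 1, so for a term \<open>a/q\<close> of order \<open>Q\<close> the neighbouring
  denominators are the solutions \<open>m\<close> of \<open>a m \<equiv> \<plusminus>1 (mod q)\<close> in the window \<open>(Q - q, Q]\<close>.  As \<open>a\<close> runs
  through the reduced residues, each of the two runs once through the \<open>m\<close> in the window that are
  coprime to \<open>q\<close>, so the indices of the terms with denominator \<open>q\<close> add up to
  \<open>(2Q - q) \<phi>(q)/q + O(\<surd>q)\<close>.

  It remains to estimate \<open>A(x) = \<Sum> \<phi>(n)/n\<close> over the \<open>B\<close>-free \<open>n \<le> x\<close> with \<open>n \<equiv> u (mod k)\<close>.  The
  summand is \<open>\<Prod>\<^sub>p (1 - e\<^sub>p [p | n])\<close> with \<open>e\<^sub>p = 1\<close> for \<open>p \<in> B\<close> and \<open>e\<^sub>p = 1/p\<close> otherwise.  Expanding over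
  finite sets \<open>D\<close> of primes, and bounding the error in counting multiples of \<open>d = \<Prod>D\<close> by \<open>(x/d)\<^sup>s\<close>,
  gives \<open>A(x) = c x + O(x\<^sup>s \<Prod>\<^sub>p (1 + e\<^sub>p p\<^sup>-\<^sup>s))\<close>, where the product converges once \<open>\<Sum>\<^bsub>p\<in>B\<^esub> p\<^sup>-\<^sup>s\<close> does.
  Any \<open>s\<close> with \<open>max \<sigma> (1/2) < s < \<theta>\<close> leaves a power of \<open>Q\<close> to spare, which is why the
  constant 1 works for every \<open>\<theta>\<close>.
\<close>

section \<open>Sieving by finite sets of primes\<close>

lemma prod_primes_dvd_iff:
  fixes D :: "nat set"
  assumes "finite D" "\<forall>p\<in>D. prime p"
  shows "\<Prod>D dvd n \<longleftrightarrow> (\<forall>p\<in>D. p dvd n)"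
  using assms
proof (induction D rule: finite_induct)
  case (insert p D)
  have "coprime p (\<Prod>D)"
    using insert.hyps insert.prems by (intro prod_coprime_right) (metis insertCI primes_coprime)
  then show ?case
    using insert by (auto intro: divides_mult dvd_mult_left dvd_mult_right)
qed simp

text \<open>Multiplying out chooses a subset \<open>D\<close> of \<open>P\<close>. Its term survives
  only if every prime in \<open>D\<close> divides \<open>n\<close>, which for distinct primes means
  that their product divides \<open>n\<close>.\<close>

lemma prod_one_minus_over_divisors:
  fixes e :: "nat \<Rightarrow> real"
  assumes "finite P" "\<forall>p\<in>P. prime p"
  shows "(\<Prod>p\<in>P. 1 - (if p dvd n then e p else 0)) =
         (\<Sum>D\<in>Pow P. (\<Prod>p\<in>D. - e p) * of_bool (\<Prod>D dvd n))"
proof -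
  have "(\<Prod>p\<in>P. 1 - (if p dvd n then e p else 0)) =
        (\<Prod>p\<in>P. (if p dvd n then - e p else 0) + 1)"
    by (intro prod.cong) auto
  also have "\<dots> = (\<Sum>D\<in>Pow P. \<Prod>p\<in>D. if p dvd n then - e p else 0)"
    by (subst prod_add[OF assms(1)]) simp
  also have "\<dots> = (\<Sum>D\<in>Pow P. (\<Prod>p\<in>D. - e p) * of_bool (\<Prod>D dvd n))"
  proof (intro sum.cong refl)
    fix D assume "D \<in> Pow P"
    then have D: "finite D" "\<forall>p\<in>D. prime p"
      using assms finite_subset by auto
    show "(\<Prod>p\<in>D. if p dvd n then - e p else 0) = (\<Prod>p\<in>D. - e p) * of_bool (\<Prod>D dvd n)"
      using D by (auto simp: prod_primes_dvd_iff intro!: prod.cong prod_zero)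
  qed
  finally show ?thesis .
qed

lemma prod_one_minus_expand:
  fixes e :: "'a \<Rightarrow> real"
  assumes "finite P"
  shows "(\<Prod>p\<in>P. 1 - e p) = (\<Sum>D\<in>Pow P. \<Prod>p\<in>D. - e p)"
  using prod_add[OF assms, of "\<lambda>p. - e p" "\<lambda>_. 1"] by simp

lemma prod_one_minus_div_expand:
  fixes e :: "nat \<Rightarrow> real"
  assumes "finite P"
  shows "(\<Prod>p\<in>P. 1 - e p / real p) = (\<Sum>D\<in>Pow P. (\<Prod>p\<in>D. - e p) / real (\<Prod>D))"
  by (subst prod_one_minus_expand[OF assms], rule sum.cong) (auto simp flip: prod_dividef)

text \<open>Dropping one full period lowers both the count and \<open>x / M\<close> by exactly 1, so
  the error reduces to the case \<open>x < M\<close>, where the count is 0 or 1.\<close>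

lemma card_residue_class_bound:
  fixes M :: nat
  assumes "M > 0"
  shows "\<bar>real (card {n\<in>{1..x}. [n = c] (mod M)}) - real x / real M\<bar> \<le> 1"
proof (induction x rule: less_induct)
  case (less x)
  let ?S = "\<lambda>x. {n\<in>{1..x}. [n = c] (mod M)}"
  show ?case
  proof (cases "x < M")
    case True
    have "card (?S x) \<le> 1"
      using True by (intro card_le_Suc0_iff_eq[THEN iffD2, folded One_nat_def])
        (auto, metis cong_less_modulus_unique_nat cong_sym cong_trans le_less_trans)
    moreover have "real x / real M < 1" "real x / real M \<ge> 0"
      using True by auto
    ultimately show ?thesis by linarith
  next
    case False
    \<comment> \<open>Counting starts at 1, so the representative of the class is taken in
      \<open>{1..M}\<close>, with \<open>M\<close> in place of 0.\<close>
    define r where "r = (if c mod M = 0 then M else c mod M)"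
    have r: "r \<in> {1..M}" "[r = c] (mod M)"
      using assms by (auto simp: r_def cong_def less_imp_le)
    have uniq: "n = r" if "n \<in> {1..M}" "[n = c] (mod M)" for n
      using that by (cases "n = M") (auto simp: r_def cong_def)
    have eq: "?S x = insert r ((\<lambda>n. n + M) ` ?S (x - M))"
    proof (intro equalityI subsetI)
      fix n assume n: "n \<in> ?S x"
      show "n \<in> insert r ((\<lambda>n. n + M) ` ?S (x - M))"
      proof (cases "n \<le> M")
        case True
        then show ?thesis using uniq n by auto
      next
        case False
        then have "n = (n - M) + M" "n - M \<in> ?S (x - M)"
          using n by (auto simp: cong_def le_mod_geq)
        then show ?thesis by blast
      qed
    next
      fix n assume "n \<in> insert r ((\<lambda>n. n + M) ` ?S (x - M))"
      then show "n \<in> ?S x" using r False by (auto simp: cong_def)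
    qed
    have "card (?S x) = Suc (card ((\<lambda>n. n + M) ` ?S (x - M)))"
      unfolding eq using r by (subst card_insert_disjoint) auto
    also have "card ((\<lambda>n. n + M) ` ?S (x - M)) = card (?S (x - M))"
      by (intro card_image) (auto intro: inj_onI)
    finally have "real (card (?S x)) = 1 + real (card (?S (x - M)))" by simp
    moreover have "real x / real M = 1 + real (x - M) / real M"
      using assms False by (simp add: of_nat_diff field_simps)
    ultimately show ?thesis
      using less.IH[of "x - M"] False assms by simp
  qed
qed

text \<open>If \<open>d \<le> x\<close>, the Chinese remainder theorem gives one class mod
  \<open>d * k\<close>, with error at most 1. If \<open>d > x\<close>, nothing is counted and the
  main term is at most \<open>x / d < 1\<close>. The power \<open>s\<close> covers both cases by a
  bound that decays in \<open>d\<close>, so that sums over \<open>d\<close> need no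
  truncation.\<close>

lemma card_residue_class_multiples_bound:
  assumes "d > 0" "k > 0" "coprime d k" "0 \<le> s" "s \<le> 1"
  shows "\<bar>real (card {n\<in>{1..x}. [n = u] (mod k) \<and> d dvd n}) - real x / (real k * real d)\<bar>
           \<le> (real x / real d) powr s"
proof (cases "d \<le> x")
  case True
  obtain c where c: "[c = 0] (mod d)" "[c = u] (mod k)"
    using binary_chinese_remainder_nat[OF assms(3)] by blast
  have "([n = u] (mod k) \<and> d dvd n) \<longleftrightarrow> [n = c] (mod (d * k))" for n
  proof -
    have "[n = c] (mod (d * k)) \<longleftrightarrow> [n = c] (mod d) \<and> [n = c] (mod k)"
      using assms(3) coprime_cong_mult_nat cong_modulus_mult_nat by (metis mult.commute)
    moreover have "[n = c] (mod d) \<longleftrightarrow> d dvd n"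
      using c(1) by (metis cong_0_iff cong_sym cong_trans)
    moreover have "[n = c] (mod k) \<longleftrightarrow> [n = u] (mod k)"
      using c(2) by (metis cong_sym cong_trans)
    ultimately show ?thesis by blast
  qed
  then have "\<bar>real (card {n\<in>{1..x}. [n = u] (mod k) \<and> d dvd n}) - real x / (real k * real d)\<bar> \<le> 1"
    using card_residue_class_bound[of "d * k" x c] assms by (simp add: mult.commute)
  also have "1 \<le> (real x / real d) powr s"
    using True assms by (intro ge_one_powr_ge_zero) auto
  finally show ?thesis .
next
  case False
  then have empty: "{n\<in>{1..x}. [n = u] (mod k) \<and> d dvd n} = {}"
    using False by (auto dest: dvd_imp_le)
  have "\<bar>real (card {n\<in>{1..x}. [n = u] (mod k) \<and> d dvd n}) - real x / (real k * real d)\<bar>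
      = real x / (real k * real d)" by (simp only: empty card.empty) simp
  also have "\<dots> \<le> real x / real d"
    using assms by (intro divide_left_mono) auto
  also have "\<dots> \<le> (real x / real d) powr s"
  proof (cases "x = 0")
    case False
    have "(real x / real d) powr 1 \<le> (real x / real d) powr s"
      using assms \<open>\<not> d \<le> x\<close> False by (intro powr_mono') auto
    then show ?thesis by simp
  qed simp
  finally show ?thesis .
qed

text \<open>Apart from 2 and 3 every prime is at least 4, hence \<open>4 ^ card D\<close> is at most
  16 times the product. Taking square roots gives the claim.\<close>

lemma two_power_card_primes_le:
  fixes D :: "nat set"
  assumes "finite D" "\<forall>p\<in>D. prime p"
  shows "2 ^ card D \<le> 4 * sqrt (real (\<Prod>D))"
proof -
  have 1: "card (D \<inter> {2, 3}) \<le> 2"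
    by (rule order_trans[OF card_mono[of "{2,3}"]]) auto
  have big: "4 \<le> p" if "p \<in> D - {2, 3}" for p
    using that assms(2) prime_ge_2_nat[of p] by fastforce
  have "card D = card (D \<inter> {2, 3}) + card (D - {2, 3})"
    using assms by (subst card_Un_disjoint[symmetric]) (auto intro: arg_cong[where f = card])
  then have "(4::nat) ^ card D = 4 ^ card (D \<inter> {2, 3}) * 4 ^ card (D - {2, 3})"
    by (simp add: power_add)
  also have "\<dots> \<le> 4 ^ 2 * \<Prod>(D - {2, 3})"
  proof (intro mult_mono)
    show "(4::nat) ^ card (D - {2, 3}) \<le> \<Prod>(D - {2, 3})"
      using prod_mono[of "D - {2, 3}" "\<lambda>_. 4" "\<lambda>p. p"] big by simp
  qed (use 1 in \<open>auto intro!: power_increasing[of _ 2 "4::nat", simplified]\<close>)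
  also have "\<Prod>(D - {2, 3}) \<le> \<Prod>D"
    using assms prime_gt_0_nat by (intro dvd_imp_le prod_dvd_prod_subset) (auto intro!: prod_pos)
  finally have "(4::nat) ^ card D \<le> 16 * \<Prod>D" by simp
  then have "(4::real) ^ card D \<le> 16 * real (\<Prod>D)"
    by (metis of_nat_le_iff of_nat_mult of_nat_numeral of_nat_power)
  then have "sqrt (4 ^ card D) \<le> sqrt (16 * real (\<Prod>D))"
    by (rule real_sqrt_le_mono)
  moreover have "sqrt ((4::real) ^ card D) = 2 ^ card D"
    by (simp add: real_sqrt_power)
  moreover have "sqrt (16 * real (\<Prod>D)) = 4 * sqrt (real (\<Prod>D))"
    by (subst real_sqrt_mult) simp
  ultimately show ?thesis by simp
qed

lemma two_power_omega_le:
  assumes "q > 0"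
  shows "2 ^ card (prime_factors q) \<le> 4 * sqrt (real q)"
proof -
  have "\<Prod>(prime_factors q) dvd q"
    by (subst prod_primes_dvd_iff) auto
  then have "\<Prod>(prime_factors q) \<le> q"
    using assms by (intro dvd_imp_le) auto
  then have "4 * sqrt (real (\<Prod>(prime_factors q))) \<le> 4 * sqrt (real q)" 
    by (simp del: of_nat_prod)
  moreover have "2 ^ card (prime_factors q) \<le> 4 * sqrt (real (\<Prod>(prime_factors q)))"
    by (intro two_power_card_primes_le) auto
  ultimately show ?thesis by linarith
qed

section \<open>The Euler product of zeta\<close>

lemma zeta_has_sum:
  assumes "s > 1"
  shows "((\<lambda>n. real n powr - s) has_sum zeta s) {0<..}"
proof -
  have "summable (\<lambda>n. 1 / real (Suc n) powr s)"
    using summable_real_powr_iff[of "- s"] assms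
    by (subst summable_Suc_iff) (simp add: powr_minus_divide)
  then have "((\<lambda>n. 1 / real (Suc n) powr s) has_sum zeta s) UNIV"
    unfolding zeta_def by (intro norm_summable_imp_has_sum summable_sums) auto
  then have "((\<lambda>n. real n powr - s) \<circ> Suc has_sum zeta s) UNIV"
    by (simp add: o_def powr_minus_divide)
  then have "((\<lambda>n. real n powr - s) has_sum zeta s) (range Suc)"
    by (subst has_sum_reindex) auto
  moreover have "range Suc = {0<..}"
    by (auto simp: image_iff) (metis Suc_pred)
  ultimately show ?thesis by simp
qed

text \<open>This is the sieve of Eratosthenes. Among the numbers left by \<open>S\<close>, the
  multiples of a new prime \<open>p\<close> are exactly \<open>p\<close> times the numbers left by
  \<open>S\<close>; they carry the fraction \<open>p^(-s)\<close> of the sum and are taken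
  away.\<close>

lemma zeta_sieved_has_sum:
  assumes "s > 1" "finite S" "\<forall>p\<in>S. prime p"
  shows "((\<lambda>n. real n powr - s) has_sum (\<Prod>p\<in>S. 1 - real p powr - s) * zeta s)
           {n. 0 < n \<and> (\<forall>p\<in>S. \<not> p dvd n)}"
  using assms(2,3)
proof (induction S rule: finite_induct)
  case empty
  then show ?case using zeta_has_sum[OF assms(1)] by (simp add: greaterThan_def)
next
  case (insert p S)
  let ?X = "{n. 0 < n \<and> (\<forall>q\<in>S. \<not> q dvd n)}" and ?f = "\<lambda>n. real n powr - s"
  let ?z = "(\<Prod>q\<in>S. 1 - real q powr - s) * zeta s"
  have p: "p > 0" "prime p" using insert.prems by (auto simp: prime_gt_0_nat)
  have X: "(?f has_sum ?z) ?X" using insert by simp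
  then have "((\<lambda>n. real p powr - s * ?f n) has_sum real p powr - s * ?z) ?X"
    by (rule has_sum_cmult_right)
  then have "(?f \<circ> (\<lambda>n. p * n) has_sum real p powr - s * ?z) ?X"
    by (simp add: o_def powr_mult)
  then have pX: "(?f has_sum real p powr - s * ?z) ((\<lambda>n. p * n) ` ?X)"
    using p by (subst has_sum_reindex) (auto intro: inj_onI)
  have ndvd: "\<not> q dvd p" if "q \<in> S" for q
    using that insert.hyps insert.prems primes_dvd_imp_eq by blast
  have sub: "(\<lambda>n. p * n) ` ?X \<subseteq> ?X"
    using p insert.prems ndvd by (auto simp: prime_dvd_mult_iff)
  have "?X - (\<lambda>n. p * n) ` ?X = {n. 0 < n \<and> (\<forall>q\<in>insert p S. \<not> q dvd n)}"
  proof (intro equalityI subsetI)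
    fix n assume n: "n \<in> ?X - (\<lambda>n. p * n) ` ?X"
    have "\<not> p dvd n"
    proof
      assume "p dvd n"
      then obtain m where "n = p * m" ..
      then have "m \<in> ?X" using n by auto
      then show False using n \<open>n = p * m\<close> by blast
    qed
    then show "n \<in> {n. 0 < n \<and> (\<forall>q\<in>insert p S. \<not> q dvd n)}" using n by auto
  qed auto
  then show ?case
    using has_sum_Diff[OF X pX sub] insert.hyps by (simp add: algebra_simps)
qed

text \<open>After sieving by the primes up to \<open>N\<close>, the number 1 remains and all others
  exceed \<open>N\<close>. Hence the finite product times \<open>zeta s\<close> differs from 1 by at
  most the tail \<open>t N\<close> of the series.\<close>

theorem inverse_zeta_prod_LIMSEQ:
  assumes "s > 1"
  shows "(\<lambda>N. \<Prod>p | prime p \<and> p \<le> N. 1 - real p powr - s) \<longlonglongrightarrow> 1 / zeta s"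
    and "zeta s \<ge> 1"
proof -
  let ?f = "\<lambda>n. real n powr - s"
  define z where "z = (\<lambda>N. (\<Prod>p | prime p \<and> p \<le> N. 1 - real p powr - s) * zeta s)"
  define t where "t = (\<lambda>N. zeta s - (\<Sum>n\<in>{1..N}. ?f n))"
  have z: "0 \<le> z N - 1 \<and> z N - 1 \<le> t N" for N
  proof -
    let ?X = "{n. 0 < n \<and> (\<forall>p\<in>{p. prime p \<and> p \<le> N}. \<not> p dvd n)}"
    have "(?f has_sum z N) ?X"
      unfolding z_def by (rule zeta_sieved_has_sum) (use assms in auto)
    moreover have "1 \<in> ?X" by (auto simp: prime_gt_Suc_0_nat)
    ultimately have "(?f has_sum z N - ?f 1) (?X - {1})"
      using has_sum_finite[of "{1}" ?f] by (intro has_sum_Diff) auto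
    then have X: "(?f has_sum z N - 1) (?X - {1})" by simp
    have T: "(?f has_sum t N) ({0<..} - {1..N})"
      unfolding t_def using zeta_has_sum[OF assms] by (intro has_sum_Diff) auto
    have gt: "n > N" if "n \<in> ?X - {1}" for n
    proof (rule ccontr)
      assume n: "\<not> n > N"
      have "n \<noteq> 1" using that by blast
      then obtain p where "prime p" "p dvd n" using prime_factor_nat by blast
      then show False using that n dvd_imp_le[of p n] by auto
    qed
    have "?X - {1} \<subseteq> {0<..} - {1..N}"
    proof
      fix n assume "n \<in> ?X - {1}"
      with gt[OF this] show "n \<in> {0<..} - {1..N}" by simp
    qed
    then have "z N - 1 \<le> t N"
      using has_sum_mono2[OF X T] by auto
    moreover have "0 \<le> z N - 1" by (rule has_sum_nonneg[OF X]) auto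
    ultimately show ?thesis by simp
  qed
  \<comment> \<open>For \<open>N = 0\<close> the product is empty, so the lower bound on
    \<open>z\<close> becomes a bound on \<open>zeta s\<close> itself.\<close>
  have "z 0 = zeta s" by (auto simp: z_def prime_gt_0_nat)
  then show ge: "zeta s \<ge> 1" using z[of 0] by simp
  have "(\<lambda>n. 1 / real (Suc n) powr s) sums zeta s"
    unfolding zeta_def using summable_real_powr_iff[of "- s"] assms
    by (intro summable_sums, subst summable_Suc_iff) (simp add: powr_minus_divide)
  then have "(\<lambda>N. \<Sum>n<N. 1 / real (Suc n) powr s) \<longlonglongrightarrow> zeta s"
    by (simp add: sums_def)
  moreover have "(\<Sum>n<N. 1 / real (Suc n) powr s) = (\<Sum>n\<in>{1..N}. ?f n)" for N
    by (rule sum.reindex_bij_witness[of _ "\<lambda>n. n - 1" Suc]) (auto simp: powr_minus_divide)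
  ultimately have "(\<lambda>N. \<Sum>n\<in>{1..N}. ?f n) \<longlonglongrightarrow> zeta s" by simp
  then have "t \<longlonglongrightarrow> zeta s - zeta s" unfolding t_def by (intro tendsto_intros)
  then have "t \<longlonglongrightarrow> 0" by simp
  then have "(\<lambda>N. z N - 1) \<longlonglongrightarrow> 0"
    by (rule tendsto_sandwich[rotated 3]) (use z in auto)
  then have "z \<longlonglongrightarrow> 1" by (simp add: LIM_zero_iff)
  then have "(\<lambda>N. z N / zeta s) \<longlonglongrightarrow> 1 / zeta s" using ge by (intro tendsto_intros) auto
  then show "(\<lambda>N. \<Prod>p | prime p \<and> p \<le> N. 1 - real p powr - s) \<longlonglongrightarrow> 1 / zeta s"
    using ge by (simp add: z_def)
qed

section \<open>Sums of totient ratios over B-free n in a residue class\<close>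

text \<open>Both the sum and its main term expand over the subsets \<open>D\<close> of
  \<open>P\<close>, and the counting bound is applied to each \<open>D\<close>; the primes of
  \<open>P\<close> do not divide \<open>k\<close>, so the product of \<open>D\<close> is coprime to
  \<open>k\<close>. The error terms are multiplicative in \<open>D\<close> and fold back into a
  product.\<close>

lemma sieve_progression_bound:
  fixes e :: "nat \<Rightarrow> real"
  assumes P: "finite P" "\<forall>p\<in>P. prime p \<and> \<not> p dvd k \<and> 0 \<le> e p"
    and "k > 0" "0 \<le> s" "s \<le> 1"
  shows "\<bar>(\<Sum>n | n \<in> {1..x} \<and> [n = u] (mod k). \<Prod>p\<in>P. 1 - (if p dvd n then e p else 0))
            - real x / real k * (\<Prod>p\<in>P. 1 - e p / real p)\<bar>
         \<le> real x powr s * (\<Prod>p\<in>P. 1 + e p * real p powr - s)"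
proof -
  let ?c = "\<lambda>D. card {n\<in>{1..x}. [n = u] (mod k) \<and> \<Prod>D dvd n}"
  have D: "finite D" "\<forall>p\<in>D. prime p" "\<Prod>D > 0" "coprime (\<Prod>D) k" "\<forall>p\<in>D. 0 \<le> e p"
    if "D \<in> Pow P" for D
    using that P finite_subset
    by (auto intro!: prod_pos prod_coprime_left prime_imp_coprime simp: prime_gt_0_nat)
  have "(\<Sum>n | n \<in> {1..x} \<and> [n = u] (mod k). \<Prod>p\<in>P. 1 - (if p dvd n then e p else 0))
      = (\<Sum>n | n \<in> {1..x} \<and> [n = u] (mod k).
           \<Sum>D\<in>Pow P. (\<Prod>p\<in>D. - e p) * of_bool (\<Prod>D dvd n))"
    using P by (intro sum.cong refl prod_one_minus_over_divisors) auto
  also have "\<dots> = (\<Sum>D\<in>Pow P. (\<Prod>p\<in>D. - e p) *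
           (\<Sum>n | n \<in> {1..x} \<and> [n = u] (mod k). of_bool (\<Prod>D dvd n)))"
    by (subst sum.swap, rule sum.cong) (simp_all only: sum_distrib_left)
  also have "\<dots> = (\<Sum>D\<in>Pow P. (\<Prod>p\<in>D. - e p) * real (?c D))"
    by (intro sum.cong refl arg_cong2[where f = "(*)"], subst sum_of_bool_eq)
       (auto intro!: arg_cong[where f = card])
  finally have 1: "(\<Sum>n | n \<in> {1..x} \<and> [n = u] (mod k). \<Prod>p\<in>P. 1 - (if p dvd n then e p else 0))
      = (\<Sum>D\<in>Pow P. (\<Prod>p\<in>D. - e p) * real (?c D))" .
  have 2: "real x / real k * (\<Prod>p\<in>P. 1 - e p / real p)
      = (\<Sum>D\<in>Pow P. (\<Prod>p\<in>D. - e p) * (real x / (real k * real (\<Prod>D))))"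
    by (simp add: prod_one_minus_div_expand[OF P(1)] sum_distrib_left mult_ac)
  have "\<bar>(\<Sum>D\<in>Pow P. (\<Prod>p\<in>D. - e p) * real (?c D))
      - (\<Sum>D\<in>Pow P. (\<Prod>p\<in>D. - e p) * (real x / (real k * real (\<Prod>D))))\<bar>
      = \<bar>\<Sum>D\<in>Pow P. (\<Prod>p\<in>D. - e p) * (real (?c D) - real x / (real k * real (\<Prod>D)))\<bar>"
    by (simp add: sum_subtractf right_diff_distrib)
  also have "\<dots> \<le> (\<Sum>D\<in>Pow P. real x powr s * (\<Prod>p\<in>D. e p * real p powr - s))"
  proof (rule sum_abs[THEN order_trans], rule sum_mono)
    fix D assume DP: "D \<in> Pow P"
    have "\<bar>(\<Prod>p\<in>D. - e p) * (real (?c D) - real x / (real k * real (\<Prod>D)))\<bar>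
        = (\<Prod>p\<in>D. e p) * \<bar>real (?c D) - real x / (real k * real (\<Prod>D))\<bar>"
      using D[OF DP] by (simp add: abs_mult abs_prod)
    also have "\<dots> \<le> (\<Prod>p\<in>D. e p) * (real x / real (\<Prod>D)) powr s"
      using D[OF DP] assms
      by (intro mult_left_mono card_residue_class_multiples_bound prod_nonneg) auto
    also have "(real x / real (\<Prod>D)) powr s = real x powr s * (\<Prod>p\<in>D. real p powr - s)"
    proof -
      have "(real x / real (\<Prod>D)) powr s = real x powr s / (\<Prod>p\<in>D. real p) powr s"
        by (simp add: powr_divide prod_nonneg)
      also have "(\<Prod>p\<in>D. real p) powr s = (\<Prod>p\<in>D. real p powr s)"
        by (subst prod_powr_distrib) auto
      also have "real x powr s / \<dots> = real x powr s * (\<Prod>p\<in>D. real p powr - s)"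
        using prod_inversef[of "\<lambda>p. real p powr s" D]
        by (simp add: powr_minus divide_inverse o_def)
      finally show ?thesis .
    qed
    finally show "\<bar>(\<Prod>p\<in>D. - e p) * (real (?c D) - real x / (real k * real (\<Prod>D)))\<bar>
        \<le> real x powr s * (\<Prod>p\<in>D. e p * real p powr - s)"
      by (simp add: prod.distrib mult_ac)
  qed
  also have "\<dots> = real x powr s * (\<Prod>p\<in>P. 1 + e p * real p powr - s)"
    using prod_one_minus_expand[OF P(1), of "\<lambda>p. - (e p * real p powr - s)"]
    by (simp flip: sum_distrib_left)
  finally show ?thesis unfolding 1 2 .
qed

text \<open>The sieve bound is applied with the primes up to \<open>N\<close> not dividing
  \<open>k\<close>, and then \<open>N\<close> tends to infinity. The constant \<open>K\<close> is
  fixed before \<open>x\<close> and \<open>u\<close>, which makes the estimate uniform in the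
  residue class.\<close>

lemma totient_ratio_sum_asymptotics:
  fixes B :: "nat set" and k :: nat and s :: real
  defines "w \<equiv> \<lambda>p. if p \<in> B \<and> \<not> p dvd k then inverse (1 + 1 / real p) else 1"
  defines "c \<equiv> 1 / (real (totient k) * zeta 2) * prodinf w
                 * (\<Prod>p | prime p \<and> p dvd k. inverse (1 + 1 / real p))"
  assumes B: "\<forall>p\<in>B. prime p" and "0 < k" and s: "0 < s" "s < 1"
    and sum: "(\<lambda>p. real p powr - s) summable_on B"
  shows "\<exists>K\<ge>0. \<forall>x u. coprime k u \<longrightarrow>
    \<bar>(\<Sum>n | n \<in> {1..x} \<and> [n = u] (mod k) \<and> B_free B n. \<Prod>p\<in>prime_factors n. 1 - 1 / real p)
       - real x * c\<bar> \<le> K * real x powr s"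
proof -
  define e where "e = (\<lambda>p. if p \<in> B then 1 else 1 / real p)"
  define P where "P = (\<lambda>N. {p. prime p \<and> p \<le> N \<and> \<not> p dvd k})"
  define b where "b = (\<lambda>p. if p \<in> B then real p powr - s else 0)"
  define R where "R = (\<Prod>p | prime p \<and> p dvd k. 1 - real p powr - 2)"
  \<comment> \<open>By \<open>1 + t \<le> exp t\<close>, the error product is controlled by the sum
    of \<open>e p * p^(-s)\<close>. On \<open>B\<close> these terms are the summable
    \<open>p^(-s)\<close>, and off \<open>B\<close> they are \<open>p^(-1-s)\<close>, summable
    because \<open>s > 0\<close>.\<close>
  define K where "K = exp (suminf b + (\<Sum>p. real p powr (- 1 - s)))"
  have finP [simp]: "finite (P N)" for N by (simp add: P_def)
  have fink [simp]: "finite {p. prime p \<and> p dvd k}" using \<open>0 < k\<close> by simp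
  have sq: "real p powr - 2 = 1 / real p ^ 2" for p
    by (simp add: powr_minus_divide)
  have sb: "summable b"
  proof -
    have "b summable_on UNIV"
      using sum by (rule summable_on_cong_neutral[THEN iffD1, rotated -1]) (auto simp: b_def)
    then show ?thesis
      by (subst (asm) summable_on_UNIV_nonneg_real_iff) (auto simp: b_def)
  qed
  have K: "(\<Prod>p\<in>P N. 1 + e p * real p powr - s) \<le> K" for N
  proof -
    have s2: "summable (\<lambda>p. real p powr (- 1 - s))"
      using s by (subst summable_real_powr_iff) auto
    have "(\<Prod>p\<in>P N. 1 + e p * real p powr - s) \<le> exp (\<Sum>p\<in>P N. e p * real p powr - s)"
      by (rule prod_le_exp_sum) (auto simp: e_def)
    also have "(\<Sum>p\<in>P N. e p * real p powr - s) \<le> (\<Sum>p\<in>P N. b p + real p powr (- 1 - s))"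
    proof (rule sum_mono)
      fix p assume "p \<in> P N"
      then have "p > 0" by (simp add: P_def prime_gt_0_nat)
      then show "e p * real p powr - s \<le> b p + real p powr (- 1 - s)"
        by (simp add: e_def b_def powr_diff powr_minus divide_inverse)
    qed
    also have "\<dots> \<le> (\<Sum>p. b p + real p powr (- 1 - s))"
      by (intro sum_le_suminf summable_add sb s2) (auto simp: b_def)
    also have "\<dots> = suminf b + (\<Sum>p. real p powr (- 1 - s))"
      by (intro suminf_add[symmetric] sb s2)
    finally show ?thesis by (simp add: K_def)
  qed
  have w_prod: "(\<lambda>N. \<Prod>p\<le>N. w p) \<longlonglongrightarrow> prodinf w"
  proof -
    \<comment> \<open>The infinite product converges absolutely: where \<open>w p\<close> is not 1,
      it differs from 1 by \<open>1 / (p + 1)\<close>, which is below \<open>p^(-s)\<close> since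
      \<open>s < 1\<close>.\<close>
    have "norm (norm (w p - 1)) \<le> b p" for p
    proof (cases "p \<in> B \<and> \<not> p dvd k")
      case True
      then have p: "p > 0" using B prime_gt_0_nat by blast
      then have "norm (norm (w p - 1)) = 1 / (real p + 1)"
        using True by (simp add: w_def field_simps)
      also have "\<dots> \<le> real p powr - 1"
        using p by (simp add: powr_minus_divide field_simps)
      also have "\<dots> \<le> real p powr - s"
        using p s by (intro powr_mono) auto
      finally show ?thesis using True by (simp add: b_def)
    qed (auto simp: w_def b_def)
    then have "summable (\<lambda>p. norm (w p - 1))"
      using sb by (rule summable_comparison_test'[rotated])
    then show ?thesis
      by (intro convergent_prod_LIMSEQ abs_convergent_prod_imp_convergent_prod
                summable_imp_abs_convergent_prod)
  qed
  have "1 - real p powr - 2 \<noteq> 0" if "prime p" for p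
  proof -
    have "1 / real p ^ 2 < 1"
      using prime_gt_1_nat[OF that] by (simp add: divide_less_eq_1)
    then show ?thesis unfolding sq by linarith
  qed
  then have R: "R \<noteq> 0"
    using fink by (simp only: R_def prod_zero_iff) blast
  \<comment> \<open>For \<open>p\<close> in \<open>B\<close>,
    \<open>1 - 1/p = (1 - 1/p^2) / (1 + 1/p)\<close>; off \<open>B\<close> the factor is just
    \<open>1 - 1/p^2\<close>. The condition \<open>N \<ge> k\<close> puts all prime divisors of
    \<open>k\<close> below \<open>N\<close>, so that dividing by \<open>R\<close> removes exactly
    their factors.\<close>
  have split: "(\<Prod>p\<in>P N. 1 - e p / real p)
      = (\<Prod>p | prime p \<and> p \<le> N. 1 - real p powr - 2) / R * (\<Prod>p\<le>N. w p)" if "N \<ge> k" for N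
  proof -
    have "(\<Prod>p\<in>P N. 1 - e p / real p) = (\<Prod>p\<in>P N. (1 - real p powr - 2) * w p)"
    proof (rule prod.cong)
      fix p assume "p \<in> P N"
      then show "1 - e p / real p = (1 - real p powr - 2) * w p"
        using prime_gt_0_nat[of p]
        by (auto simp: P_def e_def w_def sq power2_eq_square field_simps)
    qed simp
    also have "\<dots> = (\<Prod>p\<in>P N. 1 - real p powr - 2) * (\<Prod>p\<in>P N. w p)"
      by (rule prod.distrib)
    also have "(\<Prod>p\<in>P N. w p) = (\<Prod>p\<le>N. w p)"
      using B by (intro prod.mono_neutral_left) (auto simp: P_def w_def)
    also have "(\<Prod>p | prime p \<and> p \<le> N. 1 - real p powr - 2)
        = (\<Prod>p\<in>P N \<union> {p. prime p \<and> p dvd k}. 1 - real p powr - 2)"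
      using that \<open>0 < k\<close> by (intro prod.cong) (auto simp: P_def dest: dvd_imp_le)
    then have "(\<Prod>p\<in>P N. 1 - real p powr - 2)
        = (\<Prod>p | prime p \<and> p \<le> N. 1 - real p powr - 2) / R"
      using R by (subst (asm) prod.union_disjoint) (auto simp: P_def R_def)
    finally show ?thesis by simp
  qed
  have "(\<lambda>N. (\<Prod>p | prime p \<and> p \<le> N. 1 - real p powr - 2) / R * (\<Prod>p\<le>N. w p))
      \<longlonglongrightarrow> 1 / zeta 2 / R * prodinf w"
    using R by (intro tendsto_intros w_prod inverse_zeta_prod_LIMSEQ) auto
  then have lim: "(\<lambda>N. \<Prod>p\<in>P N. 1 - e p / real p) \<longlonglongrightarrow> 1 / zeta 2 / R * prodinf w"
    by (rule Lim_transform_eventually)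
       (use split in \<open>auto simp: eventually_at_top_linorder intro!: exI[of _ k]\<close>)
  \<comment> \<open>Each factor of \<open>R\<close> splits as \<open>(1 - 1/p) * (1 + 1/p)\<close>:
    the first parts turn \<open>k\<close> into \<open>totient k\<close>, the second are the
    correction for \<open>p\<close> dividing \<open>k\<close> in \<open>c\<close>.\<close>
  have c: "real k * c = 1 / zeta 2 / R * prodinf w"
  proof -
    let ?A = "{p. prime p \<and> p dvd k}"
    have pf: "prime_factors k = ?A" using \<open>0 < k\<close> by (simp add: prime_factors_dvd)
    define X Y where "X = (\<Prod>p\<in>?A. 1 - 1 / real p)" and "Y = (\<Prod>p\<in>?A. 1 + 1 / real p)"
    have XY: "R = X * Y"
      unfolding R_def X_def Y_def prod.distrib[symmetric]
      by (intro prod.cong) (auto simp: sq power2_eq_square algebra_simps)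
    have "real (totient k) = real k * X"
      using totient_formula2[of k] pf by (simp add: X_def)
    moreover have "(\<Prod>p\<in>?A. inverse (1 + 1 / real p)) = inverse Y"
      using prod_inversef[of "\<lambda>p. 1 + 1 / real p" ?A] by (simp add: o_def Y_def)
    ultimately have "c = 1 / (real k * X * zeta 2) * prodinf w * inverse Y"
      by (simp only: c_def)
    then show ?thesis using R \<open>0 < k\<close> by (simp add: XY field_simps)
  qed
  show ?thesis
  proof (intro exI[of _ K] conjI allI impI)
    show "0 \<le> K" by (simp add: K_def)
  next
    fix x u :: nat assume "coprime k u"
    let ?A = "\<Sum>n | n \<in> {1..x} \<and> [n = u] (mod k) \<and> B_free B n. \<Prod>p\<in>prime_factors n. 1 - 1 / real p"
    \<comment> \<open>Once \<open>N \<ge> x\<close> the finite product is exact: \<open>n\<close> is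
      coprime to \<open>k\<close> because \<open>u\<close> is, so all prime factors of
      \<open>n\<close> lie in \<open>P N\<close>, and one lying in \<open>B\<close> makes the
      product vanish.\<close>
    have A: "?A = (\<Sum>n | n \<in> {1..x} \<and> [n = u] (mod k). \<Prod>p\<in>P N. 1 - (if p dvd n then e p else 0))"
      if "N \<ge> x" for N
    proof -
      have zero: "(\<Prod>p\<in>P N. 1 - (if p dvd n then e p else 0)) = 
          of_bool (B_free B n) * (\<Prod>p\<in>prime_factors n. 1 - 1 / real p)"
        if n: "n \<in> {1..x}" "[n = u] (mod k)" for n
      proof -
        have ndvd: "\<not> p dvd k" if "prime p" "p dvd n" for p
          using n \<open>coprime k u\<close> that
          by (metis cong_dvd_iff coprime_common_divisor_nat coprime_cong_cong_right cong_sym not_prime_1 coprime_common_divisor not_prime_unit)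
        have pf: "prime_factors n \<subseteq> P N"
        proof
          fix p assume "p \<in> prime_factors n"
          then have p: "prime p" "p dvd n" by auto
          then have "p \<le> N" using dvd_imp_le[of p n] n \<open>N \<ge> x\<close> by simp
          then show "p \<in> P N" using p ndvd by (simp add: P_def)
        qed
        show ?thesis
        proof (cases "B_free B n")
          case True
          have "(\<Prod>p\<in>P N. 1 - (if p dvd n then e p else 0))
              = (\<Prod>p\<in>prime_factors n. 1 - (if p dvd n then e p else 0))"
            using pf n by (intro prod.mono_neutral_right) (auto simp: P_def prime_factors_dvd)
          also have "\<dots> = (\<Prod>p\<in>prime_factors n. 1 - 1 / real p)"
            using True by (intro prod.cong) (auto simp: e_def B_free_def)
          finally show ?thesis using True by simp
        next
          case False
          then obtain p where p: "p \<in> B" "p dvd n" using n by (auto simp: B_free_def)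
          then have "p \<in> P N" using pf n B by (auto simp: prime_factors_dvd)
          then show ?thesis using False p by (auto simp: e_def intro!: prod_zero)
        qed
      qed
      have "?A = (\<Sum>n | n \<in> {1..x} \<and> [n = u] (mod k).
               of_bool (B_free B n) * (\<Prod>p\<in>prime_factors n. 1 - 1 / real p))"
        by (intro sum.mono_neutral_cong_left) auto
      also have "\<dots> = (\<Sum>n | n \<in> {1..x} \<and> [n = u] (mod k).
               \<Prod>p\<in>P N. 1 - (if p dvd n then e p else 0))"
        by (intro sum.cong refl zero[symmetric]) auto
      finally show ?thesis .
    qed
    have bound: "\<bar>?A - real x / real k * (\<Prod>p\<in>P N. 1 - e p / real p)\<bar> \<le> K * real x powr s"
      if "N \<ge> x" for N
    proof -
      have "\<bar>?A - real x / real k * (\<Prod>p\<in>P N. 1 - e p / real p)\<bar>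
          \<le> real x powr s * (\<Prod>p\<in>P N. 1 + e p * real p powr - s)"
        unfolding A[OF that] using \<open>0 < k\<close> s
        by (intro sieve_progression_bound) (auto simp: P_def e_def)
      also have "\<dots> \<le> real x powr s * K" by (intro mult_left_mono K) auto
      finally show ?thesis by (simp add: mult.commute)
    qed
    \<comment> \<open>The sum \<open>?A\<close> does not involve \<open>N\<close> and the bound is
      the same for all \<open>N \<ge> x\<close>, so it passes to the limit.\<close>
    have "(\<lambda>N. \<bar>?A - real x / real k * (\<Prod>p\<in>P N. 1 - e p / real p)\<bar>)
        \<longlonglongrightarrow> \<bar>?A - real x / real k * (real k * c)\<bar>"
      unfolding c by (intro tendsto_intros lim)
    then have "\<bar>?A - real x / real k * (real k * c)\<bar> \<le> K * real x powr s"
      by (rule LIMSEQ_le_const2) (use bound in blast)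
    then show "\<bar>?A - real x * c\<bar> \<le> K * real x powr s"
      using \<open>0 < k\<close> by simp
  qed
qed

section \<open>Sums over windows of length q\<close>

text \<open>The window contains exactly \<open>t = q / d\<close> multiples of \<open>d\<close>, an
  arithmetic progression. With \<open>r = Q mod d\<close>, the error is exactly
  \<open>q / 2 - t * r\<close>, and \<open>0 \<le> t * r \<le> q\<close>.\<close>

lemma sum_multiples_window:
  fixes d q Q :: nat
  assumes "q > 0" "d dvd q" "q \<le> Q"
  shows "\<bar>(\<Sum>m | m \<in> {Q-q<..Q} \<and> d dvd m. real m) - (real Q - real q / 2) * real q / real d\<bar>
           \<le> real q / 2"
proof -
  obtain t where t: "q = d * t" using assms(2) by (elim dvdE)
  have pos: "d > 0" "t > 0" using assms t by auto
  define J where "J = Q div d"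
  define r where "r = Q mod d"
  have Q: "Q = d * J + r" and r: "r < d" using pos by (auto simp: J_def r_def)
  have tJ: "t \<le> J"
    using assms(3) pos t unfolding J_def by (simp add: less_eq_div_iff_mult_less_eq mult.commute)
  have Qq: "Q - q = d * (J - t) + r"
    using Q t tJ by (simp add: diff_mult_distrib2)
  have lt: "d * a + r < d * b \<longleftrightarrow> a < b" for a b
  proof -
    have "d * a + r < d * b \<Longrightarrow> a < b"
      by (metis add_leD1 leD leI mult_le_mono2 trans_le_add1)
    moreover have "d * a + r < d * b" if "a < b"
    proof -
      have "d * a + r < d * a + d" using r by simp
      also have "\<dots> = d * Suc a" by simp
      also have "\<dots> \<le> d * b" using that by (intro mult_le_mono2) simp
      finally show ?thesis .
    qed
    ultimately show ?thesis by blast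
  qed
  have "{m. m \<in> {Q-q<..Q} \<and> d dvd m} = (\<lambda>j. d * j) ` {J-t<..J}"
    unfolding Qq using Q lt pos by (auto simp: not_less[symmetric] elim!: dvdE)
  moreover have "inj_on (\<lambda>j. d * j) {J-t<..J}" using pos by (auto intro: inj_onI)
  ultimately have "(\<Sum>m | m \<in> {Q-q<..Q} \<and> d dvd m. real m) = real d * (\<Sum>j\<in>{J-t<..J}. real j)"
    by (simp add: sum.reindex sum_distrib_left)
  also have "(\<Sum>j\<in>{J-t<..J}. real j) = real t * real J - real t * (real t - 1) / 2"
    using tJ
  proof (induction t)
    case (Suc t)
    have "{J - Suc t<..J} = insert (J - t) {J-t<..J}" using Suc.prems by auto
    then have "(\<Sum>j\<in>{J - Suc t<..J}. real j) = real (J - t) + (\<Sum>j\<in>{J-t<..J}. real j)"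
      by simp
    then show ?case using Suc by (simp add: of_nat_diff field_simps)
  qed simp
  finally have S: "(\<Sum>m | m \<in> {Q-q<..Q} \<and> d dvd m. real m)
      = real d * (real t * real J - real t * (real t - 1) / 2)" .
  have "(\<Sum>m | m \<in> {Q-q<..Q} \<and> d dvd m. real m) - (real Q - real q / 2) * real q / real d
      = real q / 2 - real t * real r"
    using pos unfolding S unfolding t Q by (simp add: field_simps)
  moreover have "real t * real r \<le> real q"
    using r t by (simp add: mult.commute mult_right_mono)
  moreover have "real t * real r \<ge> 0" by simp
  ultimately show ?thesis by (simp only: abs_le_iff) linarith
qed

text \<open>This is inclusion-exclusion over the prime factors of \<open>q\<close>: each of the
  \<open>2 ^ card (prime_factors q)\<close> subsets costs at most \<open>q / 2\<close>.\<close>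

lemma sum_coprime_window:
  fixes q Q :: nat
  assumes "q > 0" "q \<le> Q"
  shows "\<bar>(\<Sum>m | m \<in> {Q-q<..Q} \<and> coprime m q. real m)
            - (real Q - real q / 2) * real q * (\<Prod>p\<in>prime_factors q. 1 - 1 / real p)\<bar>
           \<le> real q / 2 * 2 ^ card (prime_factors q)"
proof -
  let ?P = "prime_factors q"
  let ?s = "\<lambda>D. \<Sum>m | m \<in> {Q-q<..Q} \<and> \<Prod>D dvd m. real m"
  have ind: "of_bool (coprime m q) = (\<Prod>p\<in>?P. 1 - (if p dvd m then 1 else 0 :: real))" for m
  proof (cases "coprime m q")
    case True
    then have "\<not> p dvd m" if "p \<in> ?P" for p
      using that by (metis in_prime_factors_iff coprime_common_divisor not_prime_unit)
    then show ?thesis using True by simp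
  next
    case False
    then have "gcd m q \<noteq> 1" by (metis coprime_iff_gcd_eq_1)
    then obtain p where "prime p" "p dvd gcd m q" using prime_factor_nat[of "gcd m q"] by blast
    then have "prime p" "p dvd m" "p dvd q" by auto
    then show ?thesis using False assms
      by (auto simp: prime_factors_dvd intro!: prod_zero)
  qed
  have "(\<Sum>m | m \<in> {Q-q<..Q} \<and> coprime m q. real m)
      = (\<Sum>m\<in>{Q-q<..Q}. of_bool (coprime m q) * real m)"
    by (intro sum.mono_neutral_cong_left) auto
  also have "\<dots> = (\<Sum>m\<in>{Q-q<..Q}. \<Sum>D\<in>Pow ?P. (\<Prod>p\<in>D. - 1) * of_bool (\<Prod>D dvd m) * real m)"
  proof (intro sum.cong refl)
    fix m
    have "(\<Prod>p\<in>?P. 1 - (if p dvd m then 1 else 0 :: real))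
        = (\<Sum>D\<in>Pow ?P. (\<Prod>p\<in>D. - 1) * of_bool (\<Prod>D dvd m))"
      by (rule prod_one_minus_over_divisors) auto
    then show "of_bool (coprime m q) * real m
        = (\<Sum>D\<in>Pow ?P. (\<Prod>p\<in>D. - 1) * of_bool (\<Prod>D dvd m) * real m)"
      unfolding ind by (simp only: sum_distrib_right)
  qed
  also have "\<dots> = (\<Sum>D\<in>Pow ?P. (\<Prod>p\<in>D. - 1) * (\<Sum>m\<in>{Q-q<..Q}. of_bool (\<Prod>D dvd m) * real m))"
    by (subst sum.swap, rule sum.cong) (simp_all only: sum_distrib_left mult.assoc)
  also have "\<dots> = (\<Sum>D\<in>Pow ?P. (\<Prod>p\<in>D. - 1) * ?s D)"
    by (intro sum.cong refl arg_cong2[where f = "(*)"] sum.mono_neutral_cong_right) auto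
  finally have 1: "(\<Sum>m | m \<in> {Q-q<..Q} \<and> coprime m q. real m)
      = (\<Sum>D\<in>Pow ?P. (\<Prod>p\<in>D. - 1) * ?s D)" .
  have 2: "(real Q - real q / 2) * real q * (\<Prod>p\<in>?P. 1 - 1 / real p)
      = (\<Sum>D\<in>Pow ?P. (\<Prod>p\<in>D. - 1) * ((real Q - real q / 2) * real q / real (\<Prod>D)))"
    by (subst prod_one_minus_div_expand[of ?P "\<lambda>_. 1"]) (simp_all add: sum_distrib_left mult_ac)
  have "\<bar>(\<Sum>D\<in>Pow ?P. (\<Prod>p\<in>D. - 1) * ?s D)
      - (\<Sum>D\<in>Pow ?P. (\<Prod>p\<in>D. - 1) * ((real Q - real q / 2) * real q / real (\<Prod>D)))\<bar>
      = \<bar>\<Sum>D\<in>Pow ?P. (\<Prod>p\<in>D. - 1) * (?s D - (real Q - real q / 2) * real q / real (\<Prod>D))\<bar>"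
    by (simp only: sum_subtractf right_diff_distrib)
  also have "\<dots> \<le> (\<Sum>D\<in>Pow ?P. real q / 2)"
  proof (rule sum_abs[THEN order_trans], rule sum_mono)
    fix D assume "D \<in> Pow ?P"
    then have "finite D" "\<forall>p\<in>D. prime p \<and> p dvd q"
      using finite_subset by (auto simp: in_prime_factors_iff)
    then have "\<Prod>D dvd q" by (subst prod_primes_dvd_iff) auto
    then show "\<bar>(\<Prod>p\<in>D. - 1) * (?s D - (real Q - real q / 2) * real q / real (\<Prod>D))\<bar> \<le> real q / 2"
      using sum_multiples_window[of q "\<Prod>D" Q] assms
      by (simp add: abs_mult power_abs del: of_nat_prod)
  qed
  also have "\<dots> = real q / 2 * 2 ^ card ?P"
    by (simp add: card_Pow)
  finally show ?thesis unfolding 1 2 .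
qed

section \<open>Neighbours in the Farey sequence\<close>

text \<open>The window is a complete residue system mod \<open>q\<close>, so the description is
  unique when \<open>0 < q \<le> Q\<close> and \<open>a\<close> is coprime to \<open>q\<close>. For
  the Farey term \<open>a / q\<close>, \<open>c = 1\<close> will give the denominator on the left,
  and \<open>c = q - 1\<close>, standing for -1, the one on the right.\<close>

definition window_solution :: "nat \<Rightarrow> nat \<Rightarrow> nat \<Rightarrow> nat \<Rightarrow> nat" where
  "window_solution Q c q a = (THE m. m \<in> {Q-q<..Q} \<and> [a * m = c] (mod q))"

lemma window_cong_unique:
  fixes q Q :: nat
  assumes "m \<in> {Q-q<..Q}" "n \<in> {Q-q<..Q}" "[m = n] (mod q)" "q \<le> Q"
  shows "m = n"
proof -
  have "[m - (Q - q + 1) = n - (Q - q + 1)] (mod q)"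
    using assms by (intro cong_diff_nat) auto
  then have "m - (Q - q + 1) = n - (Q - q + 1)"
    using assms by (intro cong_less_modulus_unique_nat) auto
  then show ?thesis using assms by auto
qed

lemma window_cong_exists:
  fixes q Q c :: nat
  assumes "q > 0" "q \<le> Q"
  shows "\<exists>m\<in>{Q-q<..Q}. [m = c] (mod q)"
proof -
  \<comment> \<open>The multiple \<open>q * Q\<close> of the modulus is added only to keep the
    natural subtraction from truncating.\<close>
  define t where "t = (c + q * Q - (Q - q + 1)) mod q"
  have le: "Q - q + 1 \<le> c + q * Q"
    using assms by (cases q) auto
  have "[Q - q + 1 + t = Q - q + 1 + (c + q * Q - (Q - q + 1))] (mod q)"
    unfolding t_def by (intro cong_add) auto
  also have "Q - q + 1 + (c + q * Q - (Q - q + 1)) = c + q * Q" using le by simp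
  also have "[c + q * Q = c] (mod q)" by (simp add: cong_def)
  finally have "[Q - q + 1 + t = c] (mod q)" .
  moreover have "t < q" using assms by (simp add: t_def)
  then have "Q - q + 1 + t \<in> {Q-q<..Q}" using assms by auto
  ultimately show ?thesis by blast
qed

lemma window_solution_eqI:
  fixes q Q a :: nat
  assumes "coprime a q" "q \<le> Q" "m \<in> {Q-q<..Q}" "[a * m = c] (mod q)"
  shows "window_solution Q c q a = m"
  unfolding window_solution_def
proof (rule the_equality)
  fix n assume n: "n \<in> {Q-q<..Q} \<and> [a * n = c] (mod q)"
  then have "[a * n = a * m] (mod q)" using assms cong_sym cong_trans by blast
  then have "[n = m] (mod q)" using assms cong_mult_lcancel_nat by blast
  then show "n = m" using window_cong_unique n assms by blast
qed (use assms in auto)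

lemma window_solution:
  fixes q Q a :: nat
  assumes "coprime a q" "0 < q" "q \<le> Q"
  shows "window_solution Q c q a \<in> {Q-q<..Q}" "[a * window_solution Q c q a = c] (mod q)"
proof -
  obtain x where x: "[a * x = 1] (mod q)"
    using cong_solve_coprime_nat[OF assms(1)] by auto
  obtain m where m: "m \<in> {Q-q<..Q}" "[m = x * c] (mod q)"
    using window_cong_exists[OF assms(2,3)] by blast
  have "[a * m = a * (x * c)] (mod q)" using m cong_scalar_left by blast
  also have "[a * (x * c) = c] (mod q)"
    using cong_scalar_right[OF x, of c] by (simp add: mult.assoc)
  finally have "[a * m = c] (mod q)" .
  with m window_solution_eqI[OF assms(1,3)]
  show "window_solution Q c q a \<in> {Q-q<..Q}" "[a * window_solution Q c q a = c] (mod q)"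
    by auto
qed

text \<open>The congruence \<open>a * m = c\<close> mod \<open>q\<close> is symmetric in
  \<open>a\<close> and \<open>m\<close>. Hence the inverse map is the same construction with
  \<open>Q\<close> replaced by \<open>q\<close>, whose window is \<open>{1..q}\<close>; coprimality
  of \<open>c\<close> passes to both factors.\<close>

lemma sum_window_solution:
  fixes q Q c :: nat
  assumes "0 < q" "q \<le> Q" "coprime c q"
  shows "(\<Sum>a | a \<in> {1..q} \<and> coprime a q. f (window_solution Q c q a))
       = (\<Sum>m | m \<in> {Q-q<..Q} \<and> coprime m q. f m)"
proof (rule sum.reindex_bij_witness[of _ "window_solution q c q" "window_solution Q c q"])
  have cop: "coprime m q" if "[a * m = c] (mod q)" for a m
    using that assms(3) coprime_cong_cong_left coprime_mult_left_iff by blast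
  fix a assume "a \<in> {a. a \<in> {1..q} \<and> coprime a q}"
  then have a: "a \<in> {q-q<..q}" "coprime a q" by auto
  note w = window_solution[OF a(2) assms(1,2), of c]
  show "window_solution Q c q a \<in> {m. m \<in> {Q-q<..Q} \<and> coprime m q}"
    using w cop by blast
  show "window_solution q c q (window_solution Q c q a) = a"
    using a w cop by (intro window_solution_eqI) (auto simp: mult.commute)
next
  have cop: "coprime m q" if "[a * m = c] (mod q)" for a m
    using that assms(3) coprime_cong_cong_left coprime_mult_left_iff by blast
  fix m assume "m \<in> {m. m \<in> {Q-q<..Q} \<and> coprime m q}"
  then have m: "m \<in> {Q-q<..Q}" "coprime m q" by auto
  note w = window_solution[OF m(2) assms(1) order.refl, of c]
  show "window_solution q c q m \<in> {a. a \<in> {1..q} \<and> coprime a q}"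
    using w cop by auto
  show "window_solution Q c q (window_solution q c q m) = m"
    using m w cop assms(2) by (intro window_solution_eqI) (auto simp: mult.commute)
qed simp

section \<open>Reduced fractions and their order\<close>

lemma farey_setE:
  assumes "x \<in> farey_set Q"
  obtains a q where "x = of_nat a / of_nat q" "coprime a q" "0 < a" "a \<le> q" "q \<le> Q"
  using assms unfolding farey_set_def by blast

lemma farey_setI:
  "coprime a q \<Longrightarrow> 0 < a \<Longrightarrow> a \<le> q \<Longrightarrow> q \<le> Q \<Longrightarrow> of_nat a / of_nat q \<in> farey_set Q"
  unfolding farey_set_def by blast

lemma quotient_of_coprime_div:
  assumes "coprime a q" "0 < q"
  shows "quotient_of (of_nat a / of_nat q) = (int a, int q)"
proof -
  have "(of_nat a / of_nat q :: rat) = Fract (int a) (int q)"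
    by (simp add: Fract_of_int_quotient)
  then show ?thesis using assms by (simp add: quotient_of_Fract normalize_stable)
qed

lemma of_nat_frac_less_iff:
  fixes q m :: nat
  assumes "0 < q" "0 < m"
  shows "(of_nat a / of_nat q :: rat) < of_nat b / of_nat m \<longleftrightarrow> a * m < b * q"
proof -
  have "(of_nat a / of_nat q :: rat) < of_nat b / of_nat m
      \<longleftrightarrow> (of_nat a * of_nat m :: rat) < of_nat b * of_nat q"
    using assms by (simp add: divide_less_eq less_divide_eq mult.commute)
  then show ?thesis by (simp only: of_nat_mult[symmetric] of_nat_less_iff)
qed

text \<open>Determinant 1 gives \<open>d = q * (b * d - c * m) + m * (c * q - a * d)\<close>, and
  both brackets are positive integers when \<open>c / d\<close> lies strictly between
  \<open>a / q\<close> and \<open>b / m\<close>.\<close>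

lemma no_fraction_between:
  fixes a q b m c d :: nat
  assumes "b * q = a * m + 1" "a * d < c * q" "c * m < b * d"
  shows "q + m \<le> d"
proof -
  have 1: "int b * int q = int a * int m + 1"
    using assms(1) by (metis of_nat_1 of_nat_add of_nat_mult)
  have 2: "int c * int q - int a * int d \<ge> 1" 
    using assms(2) by (simp flip: of_nat_mult)
  have 3: "int b * int d - int c * int m \<ge> 1"
    using assms(3) by (simp flip: of_nat_mult)
  have "int d = int d * (int b * int q - int a * int m)" using 1 by simp
  also have "\<dots> = int q * (int b * int d - int c * int m) + int m * (int c * int q - int a * int d)"
    by (simp add: algebra_simps)
  also have "\<dots> \<ge> int q * 1 + int m * 1"
    using 2 3 by (intro add_mono mult_left_mono) auto
  finally show ?thesis by simp
qed

section \<open>Positions and adjacent denominators in the Farey sequence\<close>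

lemma farey_strict_mono:
  assumes "1 \<le> i" "i < j" "j \<le> farey_len Q"
  shows "farey Q i < farey Q j"
  unfolding farey_def
  using assms by (intro sorted_wrt_nth_less[OF strict_sorted_list_of_set])
    (auto simp: farey_len_def)

lemma farey_bij_betw: "bij_betw (farey Q) {1..farey_len Q} (farey_set Q)"
proof -
  have "bij_betw (\<lambda>i. sorted_list_of_set (farey_set Q) ! i) {..<farey_len Q} (farey_set Q)"
    using finite_farey_set[of Q]
    by (intro bij_betw_nth) (auto simp: farey_len_def lessThan_atLeast0)
  moreover have "bij_betw (\<lambda>i. i - 1) {1..farey_len Q} {..<farey_len Q}"
    by (rule bij_betw_byWitness[of _ Suc]) auto
  ultimately show ?thesis
    unfolding farey_def[abs_def] by (rule bij_betw_trans[rotated, unfolded o_def])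
qed

lemma farey_in: "i \<in> {1..farey_len Q} \<Longrightarrow> farey Q i \<in> farey_set Q"
  using farey_bij_betw bij_betwE by blast

lemma farey_obtain_index:
  assumes "x \<in> farey_set Q"
  obtains i where "i \<in> {1..farey_len Q}" "farey Q i = x"
  using farey_bij_betw[of Q] assms unfolding bij_betw_def by (metis imageE)

lemma farey_less_iff:
  assumes "i \<in> {1..farey_len Q}" "j \<in> {1..farey_len Q}"
  shows "farey Q i < farey Q j \<longleftrightarrow> i < j"
  using assms farey_strict_mono[of i j Q] farey_strict_mono[of j i Q]
  by (cases i j rule: linorder_cases) auto

lemma farey_denom_eq:
  assumes "farey Q i = of_nat a / of_nat q" "coprime a q" "0 < q"
  shows "farey_denom Q i = q"
  using assms by (simp add: farey_denom_def quotient_of_coprime_div)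

text \<open>The window solution \<open>m\<close> determines a fraction \<open>b / m\<close> with
  \<open>b * q - a * m = 1\<close>. Since \<open>m > Q - q\<close>, any fraction strictly between
  has denominator at least \<open>q + m > Q\<close>, so \<open>b / m\<close> is the next
  term.\<close>

lemma farey_denom_succ:
  assumes i: "1 \<le> i" "i < farey_len Q"
    and x: "farey Q i = of_nat a / of_nat q" "coprime a q" "0 < a" "a \<le> q" "q \<le> Q"
  shows "farey_denom Q (i + 1) = window_solution Q (q - 1) q a"
proof -
  define m where "m = window_solution Q (q - 1) q a"
  have q: "0 < q" using x by simp
  have m: "m \<in> {Q-q<..Q}" "[a * m = q - 1] (mod q)"
    using window_solution[OF x(2) q x(5)] by (auto simp: m_def)
  have "farey Q (i + 1) \<in> farey_set Q" using i by (intro farey_in) auto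
  then obtain c d where cd: "farey Q (i + 1) = of_nat c / of_nat d"
      "coprime c d" "0 < c" "c \<le> d" "d \<le> Q" by (rule farey_setE)
  have "farey Q i < farey Q (i + 1)" using i by (intro farey_strict_mono) auto
  then have lt: "a * d < c * q" unfolding x cd using q cd by (subst (asm) of_nat_frac_less_iff) auto
  \<comment> \<open>A further term \<open>c / d \<le> 1\<close> follows, so
    \<open>a / q < 1\<close>; this is what keeps \<open>b / m\<close> within
    \<open>(0, 1]\<close>.\<close>
  have "a \<noteq> q"
  proof
    assume "a = q"
    with lt have "d * q < c * q" by (simp add: mult.commute)
    with cd show False by simp
  qed
  have "[a * m + 1 = q - 1 + 1] (mod q)" using m(2) by (intro cong_add) auto
  then have "q dvd a * m + 1" using q by (simp add: cong_dvd_iff)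
  then obtain b where b: "b * q = a * m + 1" by (metis dvdE mult.commute)
  have "0 < b" using b by (cases b) auto
  have mpos: "0 < m" using m by simp
  have "coprime b m"
    by (rule coprimeI) (metis b coprime_common_divisor dvd_add_right_iff dvd_mult dvd_mult2 is_unit_gcd)
  have "b \<le> m"
  proof (rule ccontr)
    assume "\<not> b \<le> m"
    then have "(m + 1) * q \<le> a * m + 1" unfolding b[symmetric] by (intro mult_le_mono1) simp
    also have "a * m \<le> (q - 1) * m" using \<open>a \<noteq> q\<close> x by (intro mult_le_mono1) simp
    finally show False using mpos \<open>a \<noteq> q\<close> x(3,4) q by (cases q) (auto simp: algebra_simps)
  qed
  then have "of_nat b / of_nat m \<in> farey_set Q"
    using \<open>coprime b m\<close> \<open>0 < b\<close> m by (intro farey_setI) auto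
  then obtain j where j: "j \<in> {1..farey_len Q}" "farey Q j = of_nat b / of_nat m"
    by (rule farey_obtain_index)
  have "farey Q i < farey Q j"
    unfolding x j using q mpos b by (subst of_nat_frac_less_iff) auto
  then have "i < j" using farey_less_iff[of i Q j] i j by simp
  moreover have "\<not> i + 1 < j"
  proof
    assume "i + 1 < j"
    then have "farey Q (i + 1) < farey Q j" using j by (intro farey_strict_mono) auto
    then have "c * m < b * d"
      unfolding cd j using mpos cd by (subst (asm) of_nat_frac_less_iff) auto
    then have "q + m \<le> d" using no_fraction_between[OF b lt] by simp
    then show False using m cd x by auto
  qed
  ultimately have "j = i + 1" by simp
  then show ?thesis using farey_denom_eq[OF j(2) \<open>coprime b m\<close> mpos] by (simp add: m_def)
qed

text \<open>The argument for the successor is mirrored with \<open>a * m - b * q = 1\<close>. Here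
  the danger is \<open>b = 0\<close> instead of \<open>b > m\<close>.\<close>

lemma farey_denom_pred:
  assumes i: "1 < i" "i \<le> farey_len Q"
    and x: "farey Q i = of_nat a / of_nat q" "coprime a q" "0 < a" "a \<le> q" "q \<le> Q"
  shows "farey_denom Q (i - 1) = window_solution Q 1 q a"
proof -
  define m where "m = window_solution Q 1 q a"
  have q: "0 < q" using x by simp
  have m: "m \<in> {Q-q<..Q}" "[a * m = 1] (mod q)"
    using window_solution[OF x(2) q x(5)] by (auto simp: m_def)
  have "farey Q (i - 1) \<in> farey_set Q" using i by (intro farey_in) auto
  then obtain c d where cd: "farey Q (i - 1) = of_nat c / of_nat d"
      "coprime c d" "0 < c" "c \<le> d" "d \<le> Q" by (rule farey_setE)
  have "farey Q (i - 1) < farey Q i" using i by (intro farey_strict_mono) auto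
  then have lt: "c * q < a * d" unfolding x cd using q cd by (subst (asm) of_nat_frac_less_iff) auto
  have mpos: "0 < m" using m by simp
  have "q dvd a * m - 1" using m(2) x mpos by (subst (asm) cong_sym_eq, subst (asm) cong_altdef_nat) auto
  then obtain b where "a * m - 1 = q * b" by (elim dvdE)
  then have b: "a * m = b * q + 1" using x mpos
    by (metis Suc_eq_plus1 Suc_pred mult.commute nat_0_less_mult_iff One_nat_def)
  \<comment> \<open>If \<open>b = 0\<close>, then \<open>a = m = 1\<close> and the window forces
    \<open>q = Q\<close>, so the term is \<open>1 / Q\<close>, below which no fraction of order
    \<open>Q\<close> lies.\<close>
  have "0 < b"
  proof (rule ccontr)
    assume "\<not> 0 < b"
    then have "a = 1" "m = 1" using b by auto
    then have "q = Q" using m x by auto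
    then have "c * Q < d" using lt \<open>a = 1\<close> by simp
    moreover have "Q \<le> c * Q" using cd by simp
    ultimately show False using cd by simp
  qed
  have "coprime b m"
    by (rule coprimeI) (metis b coprime_common_divisor dvd_add_right_iff dvd_mult dvd_mult2 is_unit_gcd)
  have "b \<le> m"
  proof -
    have "b * q \<le> a * m" using b by simp
    also have "\<dots> \<le> m * q" using x by (simp add: mult.commute)
    finally show ?thesis using q by simp
  qed
  then have "of_nat b / of_nat m \<in> farey_set Q"
    using \<open>coprime b m\<close> \<open>0 < b\<close> m by (intro farey_setI) auto
  then obtain j where j: "j \<in> {1..farey_len Q}" "farey Q j = of_nat b / of_nat m"
    by (rule farey_obtain_index)
  have "farey Q j < farey Q i"
    unfolding x j using q mpos b by (subst of_nat_frac_less_iff) auto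
  then have "j < i" using farey_less_iff[of j Q i] i j by simp
  moreover have "\<not> j < i - 1"
  proof
    assume "j < i - 1"
    then have "farey Q j < farey Q (i - 1)" using j i by (intro farey_strict_mono) auto
    then have "b * d < c * m"
      unfolding cd j using mpos cd by (subst (asm) of_nat_frac_less_iff) auto
    then have "m + q \<le> d" by (rule no_fraction_between[OF b _ lt])
    then show False using m cd x by auto
  qed
  ultimately have "j = i - 1" by simp
  then show ?thesis using farey_denom_eq[OF j(2) \<open>coprime b m\<close> mpos] by (simp add: m_def)
qed

text \<open>The conventional end values fit the general formula: at \<open>1 / Q\<close> the
  solutions are 1 and \<open>Q - 1\<close>, with quotient 1, and at \<open>1 / 1\<close> both are
  \<open>Q\<close>, with quotient \<open>2 * Q\<close>. For \<open>Q = 1\<close> the formula would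
  give 2 instead of the value 1 chosen there.\<close>

lemma farey_index_eq:
  assumes "2 \<le> Q" "i \<in> {1..farey_len Q}"
    and x: "farey Q i = of_nat a / of_nat q" "coprime a q" "0 < a" "a \<le> q" "q \<le> Q"
  shows "farey_index Q i
    = (real (window_solution Q 1 q a) + real (window_solution Q (q - 1) q a)) / real q"
proof -
  have q: "0 < q" using x by simp
  consider "i = 1" | "i \<noteq> 1" "i = farey_len Q" | "1 < i" "i < farey_len Q"
    using assms(2) by fastforce
  then show ?thesis
  proof cases
    case 1
    have "(1 / of_nat Q :: rat) \<in> farey_set Q"
      using farey_setI[of 1 Q Q] assms(1) by simp
    then obtain j where j: "j \<in> {1..farey_len Q}" "farey Q j = 1 / of_nat Q"
      by (rule farey_obtain_index)
    have "\<not> farey Q j < farey Q i" using farey_less_iff[of j Q i] j assms(2) 1 by auto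
    have "\<not> 1 * q < a * Q"
    proof
      assume "1 * q < a * Q"
      then have "(of_nat 1 / of_nat Q :: rat) < of_nat a / of_nat q"
        using q assms(1) by (subst of_nat_frac_less_iff) auto
      then show False using \<open>\<not> farey Q j < farey Q i\<close> j x by simp
    qed
    moreover have "q \<le> Q" "Q \<le> a * Q" using x by auto
    ultimately have "q = Q" "a * Q = Q" by linarith+
    then have aq: "q = Q" "a = 1" using assms(1) by auto
    have "window_solution Q 1 q a = 1" "window_solution Q (q - 1) q a = Q - 1"
      using assms(1) by (auto simp: aq intro!: window_solution_eqI)
    then show ?thesis using 1 assms(1) by (simp add: farey_index_def aq of_nat_diff)
  next
    case 2
    have "(1 :: rat) \<in> farey_set Q"
      using farey_setI[of 1 1 Q] assms(1) by simp
    then obtain j where j: "j \<in> {1..farey_len Q}" "farey Q j = 1"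
      by (rule farey_obtain_index)
    have "\<not> farey Q i < farey Q j" using farey_less_iff[of i Q j] j assms(2) 2 by auto
    then have "\<not> (of_nat a / of_nat q :: rat) < of_nat 1 / of_nat 1" using x j by simp
    then have "a = q" using x q by (subst (asm) of_nat_frac_less_iff) auto
    then have aq: "q = 1" "a = 1" using x by auto
    \<comment> \<open>Modulo 1 every congruence holds, and the window of length 1 contains only
      \<open>Q\<close>.\<close>
    have "window_solution Q 1 q a = Q" "window_solution Q (q - 1) q a = Q"
      using assms(1) by (auto simp: aq cong_def intro!: window_solution_eqI)
    then show ?thesis using 2 by (simp add: farey_index_def aq)
  next
    case 3
    then show ?thesis
      using farey_denom_pred[of i Q a q] farey_denom_succ[of i Q a q] x
      by (simp add: farey_index_def farey_denom_eq[OF x(1,2) q])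
  qed
qed

text \<open>Terms are grouped by denominator \<open>q\<close>. Within a group the left and the right
  neighbour denominators each run once through the \<open>m\<close> in the window coprime to
  \<open>q\<close>, whence the factor 2.\<close>

lemma farey_moment_1_eq:
  assumes "2 \<le> Q"
  shows "farey_moment 1 B u k Q
       = (\<Sum>q | q \<in> {1..Q} \<and> [q = u] (mod k) \<and> B_free B q.
            2 / real q * (\<Sum>m | m \<in> {Q-q<..Q} \<and> coprime m q. real m))"
proof -
  define C where "C = (\<lambda>q. [q = u] (mod k) \<and> B_free B q)"
  define den where "den = (\<lambda>x. nat (snd (quotient_of x)))"
  define num where "num = (\<lambda>x. nat (fst (quotient_of x)))"
  define \<nu> where "\<nu> = (\<lambda>q a.
    (real (window_solution Q 1 q a) + real (window_solution Q (q - 1) q a)) / real q)"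
  let ?S = "SIGMA q:{q. q \<in> {1..Q} \<and> C q}. {a. a \<in> {1..q} \<and> coprime a q}"
  let ?F = "{x \<in> farey_set Q. C (den x)}"
  have dn: "den (of_nat a / of_nat q) = q" "num (of_nat a / of_nat q) = a"
    if "coprime a q" "0 < q" for a q
    using that by (simp_all add: den_def num_def quotient_of_coprime_div)
  have "farey_moment 1 B u k Q
      = (\<Sum>i | i \<in> {1..farey_len Q} \<and> C (den (farey Q i)). \<nu> (den (farey Q i)) (num (farey Q i)))"
    unfolding farey_moment_def
  proof (intro sum.cong)
    fix i assume "i \<in> {i. i \<in> {1..farey_len Q} \<and> C (den (farey Q i))}"
    then have i: "i \<in> {1..farey_len Q}" by simp
    from farey_in[OF i] obtain a q where x: "farey Q i = of_nat a / of_nat q"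
      "coprime a q" "0 < a" "a \<le> q" "q \<le> Q" by (rule farey_setE)
    then show "farey_index Q i ^ 1 = \<nu> (den (farey Q i)) (num (farey Q i))"
      using farey_index_eq[OF assms i x] by (simp add: \<nu>_def dn)
  qed (auto simp: C_def den_def farey_denom_def)
  also have "\<dots> = (\<Sum>x\<in>?F. \<nu> (den x) (num x))"
  proof (rule sum.reindex_bij_betw)
    show "bij_betw (farey Q) {i. i \<in> {1..farey_len Q} \<and> C (den (farey Q i))} ?F"
    proof (rule bij_betw_subset[OF farey_bij_betw])
      have "farey Q ` {i. i \<in> {1..farey_len Q} \<and> C (den (farey Q i))}
          = {x \<in> farey Q ` {1..farey_len Q}. C (den x)}" by fast
      then show "farey Q ` {i. i \<in> {1..farey_len Q} \<and> C (den (farey Q i))} = ?F"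
        by (simp only: bij_betw_imp_surj_on[OF farey_bij_betw])
    qed fast
  qed
  also have "\<dots> = (\<Sum>(q, a)\<in>?S. \<nu> q a)"
  proof (rule sum.reindex_bij_witness[of _ "\<lambda>(q, a). of_nat a / of_nat q" "\<lambda>x. (den x, num x)"])
    fix x assume x: "x \<in> ?F"
    then have "x \<in> farey_set Q" by simp
    then obtain a q where aq: "x = of_nat a / of_nat q"
      "coprime a q" "0 < a" "a \<le> q" "q \<le> Q" by (rule farey_setE)
    then have dx: "den x = q" "num x = a" by (simp_all add: dn)
    show "(case (den x, num x) of (q, a) \<Rightarrow> of_nat a / of_nat q) = x"
      by (simp only: dx case_prod_conv) (rule aq(1)[symmetric])
    show "(den x, num x) \<in> ?S" using x aq(2-) unfolding dx by (simp add: dx)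
  next
    fix z assume "z \<in> ?S"
    then show "(case z of (q, a) \<Rightarrow> of_nat a / of_nat q) \<in> ?F"
      "(den (case z of (q, a) \<Rightarrow> of_nat a / of_nat q), num (case z of (q, a) \<Rightarrow> of_nat a / of_nat q)) = z"
      by (auto simp: dn intro!: farey_setI)
  qed auto
  also have "\<dots> = (\<Sum>q | q \<in> {1..Q} \<and> C q. \<Sum>a | a \<in> {1..q} \<and> coprime a q. \<nu> q a)"
    by (rule sum.Sigma[symmetric]) auto
  also have "\<dots> = (\<Sum>q | q \<in> {1..Q} \<and> C q.
      2 / real q * (\<Sum>m | m \<in> {Q-q<..Q} \<and> coprime m q. real m))"
  proof (intro sum.cong refl)
    fix q assume "q \<in> {q. q \<in> {1..Q} \<and> C q}"
    then have q: "0 < q" "q \<le> Q" by auto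
    have "coprime (q - 1) q" using q by (intro coprime_diff_one_left_nat)
    then show "(\<Sum>a | a \<in> {1..q} \<and> coprime a q. \<nu> q a)
        = 2 / real q * (\<Sum>m | m \<in> {Q-q<..Q} \<and> coprime m q. real m)"
      using sum_window_solution[OF q, of 1 real] sum_window_solution[OF q, of "q - 1" real]
      by (simp add: \<nu>_def sum.distrib flip: sum_divide_distrib)
  qed
  finally show ?thesis by (simp add: C_def)
qed

section \<open>The first moment\<close>

text \<open>This is Abel summation: \<open>2 * Q - n = Q + (Q - n)\<close>, and \<open>Q - n\<close>
  counts the \<open>x\<close> with \<open>n \<le> x < Q\<close>.\<close>

lemma sum_summatory:
  fixes h :: "nat \<Rightarrow> real"
  shows "(\<Sum>n\<in>{1..Q}. (2 * real Q - real n) * h n)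
       = real Q * (\<Sum>n\<in>{1..Q}. h n) + (\<Sum>x<Q. \<Sum>n\<in>{1..x}. h n)"
proof (induction Q)
  case (Suc Q)
  have "(\<Sum>n\<in>{1..Q}. (2 * real (Suc Q) - real n) * h n)
      = (\<Sum>n\<in>{1..Q}. (2 * real Q - real n) * h n) + 2 * (\<Sum>n\<in>{1..Q}. h n)"
    by (simp add: sum.distrib sum_distrib_left sum_subtractf algebra_simps)
  then show ?case using Suc by (simp add: algebra_simps)
qed simp

lemma sum_summatory_filter:
  fixes g :: "nat \<Rightarrow> real"
  shows "(\<Sum>n | n \<in> {1..Q} \<and> P n. (2 * real Q - real n) * g n)
       = real Q * (\<Sum>n | n \<in> {1..Q} \<and> P n. g n) + (\<Sum>x<Q. \<Sum>n | n \<in> {1..x} \<and> P n. g n)"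
proof -
  have f: "(\<Sum>n | n \<in> {1..x} \<and> P n. f n) = (\<Sum>n\<in>{1..x}. if P n then f n else 0)"
    for f :: "nat \<Rightarrow> real" and x
    by (intro sum.mono_neutral_cong_left) auto
  have "(\<Sum>n\<in>{1..Q}. if P n then (2 * real Q - real n) * g n else 0)
      = (\<Sum>n\<in>{1..Q}. (2 * real Q - real n) * (if P n then g n else 0))"
    by (intro sum.cong) auto
  then show ?thesis unfolding f by (simp only: sum_summatory)
qed

text \<open>The main terms \<open>c * Q^2\<close> and \<open>c * Q * (Q - 1) / 2\<close> add up to
  \<open>3/2 * c * Q^2 - c * Q / 2\<close>. The last piece accounts for \<open>\<bar>c\<bar>\<close>
  in the bound, and the two error sums for \<open>2 * K\<close>.\<close>

lemma sum_summatory_linear_bound: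
  fixes A :: "nat \<Rightarrow> real"
  assumes A: "\<And>x. \<bar>A x - real x * c\<bar> \<le> K * real x powr s" and "0 \<le> K" "0 \<le> s" "0 < Q"
  shows "\<bar>real Q * A Q + (\<Sum>x<Q. A x) - 3 / 2 * c * real Q ^ 2\<bar>
           \<le> (2 * K + \<bar>c\<bar>) * real Q powr (1 + s)"
proof -
  have Qs: "real Q powr (1 + s) = real Q * real Q powr s"
    using assms by (simp add: powr_add)
  have 1: "\<bar>real Q * A Q - real Q * (real Q * c)\<bar> \<le> K * real Q powr (1 + s)"
  proof -
    have "\<bar>real Q * A Q - real Q * (real Q * c)\<bar> = real Q * \<bar>A Q - real Q * c\<bar>"
      by (simp add: abs_mult flip: right_diff_distrib)
    also have "\<dots> \<le> real Q * (K * real Q powr s)" by (intro mult_left_mono A) auto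
    finally show ?thesis by (simp add: Qs mult_ac)
  qed
  have "\<bar>(\<Sum>x<Q. A x) - (\<Sum>x<Q. real x * c)\<bar> \<le> (\<Sum>x<Q. \<bar>A x - real x * c\<bar>)"
    unfolding sum_subtractf[symmetric] by (rule sum_abs)
  also have "\<dots> \<le> (\<Sum>x<Q. K * real Q powr s)"
  proof (rule sum_mono)
    fix x assume "x \<in> {..<Q}"
    then have "K * real x powr s \<le> K * real Q powr s"
      using assms by (intro mult_left_mono powr_mono2) auto
    then show "\<bar>A x - real x * c\<bar> \<le> K * real Q powr s" using A[of x] by linarith
  qed
  also have "\<dots> = K * real Q powr (1 + s)" by (simp add: Qs)
  finally have 2: "\<bar>(\<Sum>x<Q. A x) - (\<Sum>x<Q. real x * c)\<bar> \<le> K * real Q powr (1 + s)" .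
  have 3: "(\<Sum>x<Q. real x * c) = c * real Q ^ 2 / 2 - c * real Q / 2"
    by (induction Q) (auto simp: field_simps power2_eq_square)
  have "1 \<le> real Q powr s" using assms by (intro ge_one_powr_ge_zero) auto
  then have "real Q * 1 \<le> real Q powr (1 + s)" unfolding Qs by (intro mult_left_mono) auto
  then have "\<bar>c\<bar> * (real Q * 1) \<le> \<bar>c\<bar> * real Q powr (1 + s)" by (intro mult_left_mono) auto
  moreover have "\<bar>c * real Q / 2\<bar> = \<bar>c\<bar> * real Q / 2" by (simp add: abs_mult)
  moreover have "0 \<le> \<bar>c\<bar> * real Q" by simp
  ultimately have 4: "\<bar>c * real Q / 2\<bar> \<le> \<bar>c\<bar> * real Q powr (1 + s)"
    by linarith
  have "real Q * A Q + (\<Sum>x<Q. A x) - 3 / 2 * c * real Q ^ 2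
      = (real Q * A Q - real Q * (real Q * c)) + ((\<Sum>x<Q. A x) - (\<Sum>x<Q. real x * c)) - c * real Q / 2"
    unfolding 3 by (simp add: power2_eq_square)
  moreover have "(2 * K + \<bar>c\<bar>) * real Q powr (1 + s)
      = K * real Q powr (1 + s) + K * real Q powr (1 + s) + \<bar>c\<bar> * real Q powr (1 + s)"
    by (simp add: algebra_simps)
  ultimately show ?thesis using 1 2 4 by linarith
qed

text \<open>Each denominator \<open>q\<close> contributes an error of at most
  \<open>2 ^ card (prime_factors q)\<close>, hence at most \<open>4 * sqrt Q\<close>, and there are
  at most \<open>Q\<close> denominators.\<close>

lemma farey_moment_1_approx:
  assumes "2 \<le> Q"
  shows "\<bar>farey_moment 1 B u k Q
     - (\<Sum>q | q \<in> {1..Q} \<and> [q = u] (mod k) \<and> B_free B q.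
          (2 * real Q - real q) * (\<Prod>p\<in>prime_factors q. 1 - 1 / real p))\<bar>
     \<le> 4 * real Q powr (3/2)"
proof -
  let ?G = "{q. q \<in> {1..Q} \<and> [q = u] (mod k) \<and> B_free B q}"
  let ?W = "\<lambda>q. \<Sum>m | m \<in> {Q-q<..Q} \<and> coprime m q. real m"
  let ?g = "\<lambda>q. \<Prod>p\<in>prime_factors q. 1 - 1 / real p"
  have "\<bar>(\<Sum>q\<in>?G. 2 / real q * ?W q) - (\<Sum>q\<in>?G. (2 * real Q - real q) * ?g q)\<bar>
      \<le> (\<Sum>q\<in>?G. \<bar>2 / real q * ?W q - (2 * real Q - real q) * ?g q\<bar>)"
    unfolding sum_subtractf[symmetric] by (rule sum_abs)
  also have "\<dots> \<le> (\<Sum>q\<in>?G. 4 * sqrt (real Q))"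
  proof (rule sum_mono)
    fix q assume "q \<in> ?G"
    then have q: "0 < q" "q \<le> Q" by auto
    have eq: "2 / real q * ?W q - (2 * real Q - real q) * ?g q
        = 2 / real q * (?W q - (real Q - real q / 2) * real q * ?g q)"
      using q by (simp add: field_simps)
    have "\<bar>2 / real q * ?W q - (2 * real Q - real q) * ?g q\<bar>
        = 2 / real q * \<bar>?W q - (real Q - real q / 2) * real q * ?g q\<bar>"
      unfolding eq abs_mult by simp
    also have "\<dots> \<le> 2 / real q * (real q / 2 * 2 ^ card (prime_factors q))"
      using q by (intro mult_left_mono sum_coprime_window) auto
    also have "\<dots> = 2 ^ card (prime_factors q)" using q by simp
    also have "\<dots> \<le> 4 * sqrt (real q)" using q by (intro two_power_omega_le)
    also have "\<dots> \<le> 4 * sqrt (real Q)" using q by simp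
    finally show "\<bar>2 / real q * ?W q - (2 * real Q - real q) * ?g q\<bar> \<le> 4 * sqrt (real Q)" .
  qed
  also have "\<dots> = real (card ?G) * (4 * sqrt (real Q))" by simp
  also have "\<dots> \<le> real Q * (4 * sqrt (real Q))"
  proof (intro mult_right_mono)
    have "card ?G \<le> card {1..Q}" by (intro card_mono) auto
    then show "real (card ?G) \<le> real Q" by simp
  qed auto
  also have "\<dots> = 4 * real Q powr (1 + 1/2)"
    using assms unfolding powr_add by (simp add: powr_half_sqrt)
  finally show ?thesis unfolding farey_moment_1_eq[OF assms] by simp
qed

theorem theorem1p2:
  fixes B :: "nat set" and k :: nat
  assumes "infinite B" and "\<forall>p\<in>B. prime p" and "0 < k"
  shows "\<exists>C::real. \<forall>\<theta>::real.
    1/2 < \<theta> \<and> \<theta> < 1 \<and> (\<exists>\<sigma><\<theta>. (\<lambda>p. real p powr (- \<sigma>)) summable_on B) \<longrightarrow>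
    (\<forall>\<^sub>F Q in sequentially. \<forall>u::nat. 0 < u \<and> coprime k u \<longrightarrow>
      \<bar>farey_moment 1 B u k Q
        - 3 * real Q ^ 2 / (2 * real (totient k) * zeta 2)
          * (\<Prod>p. if p \<in> B \<and> \<not> p dvd k then inverse (1 + 1 / real p) else 1)
          * (\<Prod>p | prime p \<and> p dvd k. inverse (1 + 1 / real p))\<bar>
      \<le> C * (real Q powr (1 + \<theta>) * ln (real Q) powr (3/2)))"
proof (intro exI[of _ 1] allI impI, elim conjE exE)
  fix \<theta> \<sigma> :: real
  assume \<theta>: "1/2 < \<theta>" "\<theta> < 1" and \<sigma>: "\<sigma> < \<theta>" "(\<lambda>p. real p powr (- \<sigma>)) summable_on B"
  \<comment> \<open>The midpoint leaves room on both sides: \<open>s > \<sigma>\<close> keeps the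
    sum over \<open>B\<close> convergent, \<open>s > 1/2\<close> lets \<open>Q^(1+s)\<close> absorb
    the window error \<open>Q^(3/2)\<close>, and \<open>s < \<theta>\<close> leaves the power
    \<open>Q^(\<theta>-s)\<close> to outgrow \<open>?K\<close>.\<close>
  define s where "s = (max \<sigma> (1/2) + \<theta>) / 2"
  have s: "1/2 < s" "\<sigma> < s" "s < \<theta>" using \<theta> \<sigma> by (auto simp: s_def max_def)
  have sum: "(\<lambda>p. real p powr - s) summable_on B"
  proof (rule summable_on_comparison_test[OF \<sigma>(2)])
    fix p assume "p \<in> B"
    then have "p \<ge> 1" using assms(2) prime_ge_1_nat by blast
    then show "real p powr - s \<le> real p powr - \<sigma>" using s by (intro powr_mono) auto
  qed auto
  define w where "w = (\<lambda>p. if p \<in> B \<and> \<not> p dvd k then inverse (1 + 1 / real p) else 1)"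
  define c where "c = 1 / (real (totient k) * zeta 2) * prodinf w
                 * (\<Prod>p | prime p \<and> p dvd k. inverse (1 + 1 / real p))"
  obtain K where K: "0 \<le> K" "\<And>x u. coprime k u \<Longrightarrow>
    \<bar>(\<Sum>n | n \<in> {1..x} \<and> [n = u] (mod k) \<and> B_free B n. \<Prod>p\<in>prime_factors n. 1 - 1 / real p)
       - real x * c\<bar> \<le> K * real x powr s"
    using totient_ratio_sum_asymptotics[of B k s] assms s \<theta> sum unfolding c_def w_def by auto
  let ?K = "4 + (2 * K + \<bar>c\<bar>)"
  have bound: "\<bar>farey_moment 1 B u k Q - 3 / 2 * c * real Q ^ 2\<bar> \<le> ?K * real Q powr (1 + s)"
    if "2 \<le> Q" "coprime k u" for Q u
  proof -
    let ?g = "\<lambda>q. \<Prod>p\<in>prime_factors q. 1 - 1 / real p"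
    let ?A = "\<lambda>x. \<Sum>n | n \<in> {1..x} \<and> [n = u] (mod k) \<and> B_free B n. ?g n"
    have "\<bar>farey_moment 1 B u k Q - (real Q * ?A Q + (\<Sum>x<Q. ?A x))\<bar> \<le> 4 * real Q powr (3/2)"
      using farey_moment_1_approx[OF that(1), of B u k] by (simp only: sum_summatory_filter)
    moreover have "\<bar>real Q * ?A Q + (\<Sum>x<Q. ?A x) - 3 / 2 * c * real Q ^ 2\<bar>
        \<le> (2 * K + \<bar>c\<bar>) * real Q powr (1 + s)"
      using K that s by (intro sum_summatory_linear_bound) auto
    moreover have "real Q powr (3/2) \<le> real Q powr (1 + s)"
      using that s by (intro powr_mono) auto
    ultimately show ?thesis by (simp only: distrib_right)
  qed
  have "filterlim (\<lambda>Q. real Q powr (\<theta> - s)) at_top sequentially"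
    using s by real_asymp
  then have "\<forall>\<^sub>F Q in sequentially. ?K \<le> real Q powr (\<theta> - s)"
    by (simp only: filterlim_at_top)
  \<comment> \<open>As \<open>exp 1 \<le> 3\<close>, this makes \<open>ln Q \<ge> 1\<close>, so the
    logarithmic factor can only enlarge the bound.\<close>
  moreover have "\<forall>\<^sub>F Q::nat in sequentially. 3 \<le> Q" by (rule eventually_ge_at_top)
  ultimately show "\<forall>\<^sub>F Q in sequentially. \<forall>u::nat. 0 < u \<and> coprime k u \<longrightarrow>
      \<bar>farey_moment 1 B u k Q
        - 3 * real Q ^ 2 / (2 * real (totient k) * zeta 2)
          * (\<Prod>p. if p \<in> B \<and> \<not> p dvd k then inverse (1 + 1 / real p) else 1)
          * (\<Prod>p | prime p \<and> p dvd k. inverse (1 + 1 / real p))\<bar>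
      \<le> 1 * (real Q powr (1 + \<theta>) * ln (real Q) powr (3/2))"
  proof eventually_elim
    case (elim Q)
    have "ln (real Q) \<ge> 1"
      using elim exp_le by (subst ln_ge_iff) auto
    then have ln: "1 \<le> ln (real Q) powr (3/2)" by (intro ge_one_powr_ge_zero) auto
    have main: "3 * real Q ^ 2 / (2 * real (totient k) * zeta 2)
          * (\<Prod>p. if p \<in> B \<and> \<not> p dvd k then inverse (1 + 1 / real p) else 1)
          * (\<Prod>p | prime p \<and> p dvd k. inverse (1 + 1 / real p)) = 3 / 2 * c * real Q ^ 2"
      unfolding c_def w_def by (simp add: mult_ac)
    have "?K * real Q powr (1 + s) \<le> real Q powr (\<theta> - s) * real Q powr (1 + s)"
      using elim by (intro mult_right_mono) auto
    also have "\<dots> = real Q powr (\<theta> - s + (1 + s))" by (rule powr_add[symmetric])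
    also have "\<theta> - s + (1 + s) = 1 + \<theta>" by simp
    also have "real Q powr (1 + \<theta>) = real Q powr (1 + \<theta>) * 1" by simp
    also have "\<dots> \<le> real Q powr (1 + \<theta>) * ln (real Q) powr (3/2)"
      using ln by (intro mult_left_mono) auto
    finally have le: "?K * real Q powr (1 + s) \<le> 1 * (real Q powr (1 + \<theta>) * ln (real Q) powr (3/2))"
      by simp
    show ?case
      unfolding main
    proof (intro allI impI, elim conjE)
      fix u assume "coprime k u"
      then show "\<bar>farey_moment 1 B u k Q - 3 / 2 * c * real Q ^ 2\<bar>
          \<le> 1 * (real Q powr (1 + \<theta>) * ln (real Q) powr (3/2))"
        using bound[of Q u] elim by (intro order_trans[OF _ le]) auto
    qed
  qed
qed

end
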